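(* The class $\mathrm{CSA}^\ast$ is closed under free products: the free product of any family of $\mathrm{CSA}^\ast$-groups is a $\mathrm{CSA}^\ast$-group.
   Context: A subgroup $H$ of a group $G$ is conjugately separated (malnormal) if $H\cap H^x=1$ for every $x\in G\setminus H$, where $H^x=x^{-1}Hx$. A group $G$ is a CSA-group if all its maximal abelian subgroups are conjugately separated. $\mathrm{CSA}^\ast$ is the class of all CSA-groups without elements of order $2$. *)

theory Defs
  imports "HOL-Algebra.Multiplicative_Group"
begin

section \<open>CSA-groups\<close>

definition abelian_subgroup :: "('a, 'b) monoid_scheme \<Rightarrow> 'a set \<Rightarrow> bool" where
  "abelian_subgroup G A \<longleftrightarrow> subgroup A G \<and> comm_group (G\<lparr>carrier := A\<rparr>)"

definition maximal_abelian_subgroup :: "('a, 'b) monoid_scheme \<Rightarrow> 'a set \<Rightarrow> bool" where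
  "maximal_abelian_subgroup G A \<longleftrightarrow>
     abelian_subgroup G A \<and> (\<forall>B. abelian_subgroup G B \<and> A \<subseteq> B \<longrightarrow> B = A)"

definition conjugate_subgroup :: "('a, 'b) monoid_scheme \<Rightarrow> 'a set \<Rightarrow> 'a \<Rightarrow> 'a set" where
  "conjugate_subgroup G H x = (\<lambda>h. inv\<^bsub>G\<^esub> x \<otimes>\<^bsub>G\<^esub> h \<otimes>\<^bsub>G\<^esub> x) ` H"

definition conjugately_separated :: "('a, 'b) monoid_scheme \<Rightarrow> 'a set \<Rightarrow> bool" where
  "conjugately_separated G H \<longleftrightarrow>
     subgroup H G \<and> (\<forall>x \<in> carrier G - H. H \<inter> conjugate_subgroup G H x = {\<one>\<^bsub>G\<^esub>})"

definition CSA_group :: "('a, 'b) monoid_scheme \<Rightarrow> bool" where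
  "CSA_group G \<longleftrightarrow>
     group G \<and> (\<forall>A. maximal_abelian_subgroup G A \<longrightarrow> conjugately_separated G A)"

definition CSA_star_group :: "('a, 'b) monoid_scheme \<Rightarrow> bool" where
  "CSA_star_group G \<longleftrightarrow> CSA_group G \<and> \<not> (\<exists>x \<in> carrier G. group.ord G x = 2)"


section \<open>Free products\<close>

text \<open>
  The free product of the groups \<open>G i\<close> (\<open>i \<in> I\<close>) is modelled by its normal forms: words
  of syllables \<open>(i, g)\<close> with \<open>g\<close> a nontrivial element of \<open>G i\<close>, in which neighbouring
  syllables come from different factors. The index in a syllable makes the copies of
  the factors disjoint, so the groups \<open>G i\<close> may share elements (or even coincide).
\<close>

definition reduced_words :: "'i set \<Rightarrow> ('i \<Rightarrow> ('a, 'b) monoid_scheme) \<Rightarrow> ('i \<times> 'a) list set" where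
  "reduced_words I G =
     {w. set w \<subseteq> (SIGMA i:I. carrier (G i) - {\<one>\<^bsub>G i\<^esub>}) \<and> distinct_adj (map fst w)}"

text \<open>
  Left multiplication of a reduced word by one syllable, which is allowed to be trivial:
  a syllable of the same factor is merged with it, and a trivial result is deleted. After
  a deletion the rest of the word is still reduced, so nothing further can cancel.
\<close>

fun syllable_mult ::
  "('i \<Rightarrow> ('a, 'b) monoid_scheme) \<Rightarrow> 'i \<times> 'a \<Rightarrow> ('i \<times> 'a) list \<Rightarrow> ('i \<times> 'a) list" where
  "syllable_mult G (i, g) [] = (if g = \<one>\<^bsub>G i\<^esub> then [] else [(i, g)])"
| "syllable_mult G (i, g) ((j, h) # w) =
     (if i = j then (if g \<otimes>\<^bsub>G i\<^esub> h = \<one>\<^bsub>G i\<^esub> then w else (i, g \<otimes>\<^bsub>G i\<^esub> h) # w)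
      else if g = \<one>\<^bsub>G i\<^esub> then (j, h) # w else (i, g) # (j, h) # w)"

definition free_product ::
  "'i set \<Rightarrow> ('i \<Rightarrow> ('a, 'b) monoid_scheme) \<Rightarrow> ('i \<times> 'a) list monoid" where
  "free_product I G =
     \<lparr>carrier = reduced_words I G, mult = (\<lambda>u v. foldr (syllable_mult G) u v), one = []\<rparr>"

definition free_product_embed ::
  "('i \<Rightarrow> ('a, 'b) monoid_scheme) \<Rightarrow> 'i \<Rightarrow> 'a \<Rightarrow> ('i \<times> 'a) list" where
  "free_product_embed G i g = syllable_mult G (i, g) []"

subsection \<open>Group structure and universal property\<close>

lemma reduced_words_Nil [simp]: "[] \<in> reduced_words I G"
  by (simp add: reduced_words_def)

lemma reduced_words_Cons:
  "(i, g) # w \<in> reduced_words I G \<longleftrightarrow>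
     i \<in> I \<and> g \<in> carrier (G i) \<and> g \<noteq> \<one>\<^bsub>G i\<^esub> \<and> w \<in> reduced_words I G \<and> (w = [] \<or> fst (hd w) \<noteq> i)"
  by (cases w) (auto simp: reduced_words_def)

context
  fixes I :: "'i set" and G :: "'i \<Rightarrow> ('a, 'b) monoid_scheme"
  assumes groups: "\<And>i. i \<in> I \<Longrightarrow> group (G i)"
begin

lemma syllable_mult_closed:
  assumes "i \<in> I" "g \<in> carrier (G i)" "w \<in> reduced_words I G"
  shows "syllable_mult G (i, g) w \<in> reduced_words I G"
proof -
  interpret group "G i" using groups assms(1) .
  show ?thesis
    using assms by (cases w) (auto simp: reduced_words_Cons)
qed

lemma syllable_mult_one:
  assumes "i \<in> I" "w \<in> reduced_words I G"
  shows "syllable_mult G (i, \<one>\<^bsub>G i\<^esub>) w = w"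
proof -
  interpret group "G i" using groups assms(1) .
  show ?thesis
    using assms by (cases w) (auto simp: reduced_words_Cons)
qed

lemma syllable_mult_mult:
  assumes "i \<in> I" "g \<in> carrier (G i)" "h \<in> carrier (G i)" "w \<in> reduced_words I G"
  shows "syllable_mult G (i, g) (syllable_mult G (i, h) w) = syllable_mult G (i, g \<otimes>\<^bsub>G i\<^esub> h) w"
proof -
  interpret group "G i" using groups assms(1) .
  show ?thesis
  proof (cases w)
    case Nil
    then show ?thesis using assms by simp
  next
    case (Cons p v)
    obtain j k where p: "p = (j, k)" by (cases p)
    have jk: "j \<in> I" "k \<in> carrier (G j)" "k \<noteq> \<one>\<^bsub>G j\<^esub>" "v \<in> reduced_words I G"
      "v = [] \<or> fst (hd v) \<noteq> j"
      using assms(4) by (auto simp: Cons p reduced_words_Cons)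
    show ?thesis
    proof (cases "i = j")
      case False
      then show ?thesis using assms jk by (auto simp: Cons p)
    next
      case True
      have k: "k \<in> carrier (G i)" and v: "v = [] \<or> fst (hd v) \<noteq> i" using jk True by auto
      have gh: "g \<otimes>\<^bsub>G i\<^esub> h \<otimes>\<^bsub>G i\<^esub> k = g \<otimes>\<^bsub>G i\<^esub> (h \<otimes>\<^bsub>G i\<^esub> k)"
        using assms k by (simp add: m_assoc)
      show ?thesis
      proof (cases "h \<otimes>\<^bsub>G i\<^esub> k = \<one>\<^bsub>G i\<^esub>")
        case hk: True
        then have "g \<otimes>\<^bsub>G i\<^esub> h \<otimes>\<^bsub>G i\<^esub> k = g" using gh assms by simp
        then show ?thesis using v True hk
          by (cases v) (auto simp: Cons p)
      next
        case False
        then show ?thesis using gh True by (simp add: Cons p)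
      qed
    qed
  qed
qed

lemma foldr_syllable_mult_closed:
  assumes "u \<in> reduced_words I G" "v \<in> reduced_words I G"
  shows "foldr (syllable_mult G) u v \<in> reduced_words I G"
  using assms by (induction u) (auto simp: reduced_words_Cons intro!: syllable_mult_closed)

lemma foldr_syllable_mult_Nil:
  assumes "u \<in> reduced_words I G"
  shows "foldr (syllable_mult G) u [] = u"
  using assms
proof (induction u)
  case (Cons p u)
  then show ?case by (cases p, cases u) (auto simp: reduced_words_Cons)
qed simp

lemma foldr_syllable_mult:
  assumes "i \<in> I" "g \<in> carrier (G i)" "u \<in> reduced_words I G" "v \<in> reduced_words I G"
  shows "foldr (syllable_mult G) (syllable_mult G (i, g) u) v =
         syllable_mult G (i, g) (foldr (syllable_mult G) u v)"
proof -
  interpret group "G i" using groups assms(1) .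
  show ?thesis
  proof (cases u)
    case Nil
    then show ?thesis using assms by (auto simp: syllable_mult_one)
  next
    case (Cons p w)
    obtain j k where p: "p = (j, k)" by (cases p)
    have jk: "j \<in> I" "k \<in> carrier (G j)" "w \<in> reduced_words I G"
      using assms(3) by (auto simp: Cons p reduced_words_Cons)
    have wv: "foldr (syllable_mult G) w v \<in> reduced_words I G"
      using jk assms foldr_syllable_mult_closed by blast
    show ?thesis
    proof (cases "i = j")
      case True
      then have k: "k \<in> carrier (G i)" using jk by simp
      have "syllable_mult G (i, g) (foldr (syllable_mult G) u v) =
            syllable_mult G (i, g \<otimes>\<^bsub>G i\<^esub> k) (foldr (syllable_mult G) w v)"
        using syllable_mult_mult[OF assms(1,2) k wv] by (simp add: Cons p True)
      then show ?thesis
        using syllable_mult_one[OF assms(1) wv] True by (simp add: Cons p)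
    next
      case False
      have "syllable_mult G (j, k) (foldr (syllable_mult G) w v) \<in> reduced_words I G"
        using syllable_mult_closed[OF jk(1,2) wv] .
      then show ?thesis
        using False assms(1) by (auto simp: Cons p syllable_mult_one)
    qed
  qed
qed

lemma foldr_syllable_mult_assoc:
  assumes "u \<in> reduced_words I G" "v \<in> reduced_words I G" "w \<in> reduced_words I G"
  shows "foldr (syllable_mult G) (foldr (syllable_mult G) u v) w =
         foldr (syllable_mult G) u (foldr (syllable_mult G) v w)"
  using assms(1)
proof (induction u)
  case (Cons p u)
  then show ?case
    using assms(2,3)
    by (cases p) (auto simp: reduced_words_Cons foldr_syllable_mult foldr_syllable_mult_closed)
qed simp

lemma free_product_left_inverse:
  assumes "u \<in> reduced_words I G"
  shows "\<exists>v \<in> reduced_words I G. foldr (syllable_mult G) v u = []"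
  using assms
proof (induction u)
  case Nil
  then show ?case by (intro bexI[of _ "[]"]) auto
next
  case (Cons p u)
  obtain i g where p: "p = (i, g)" by (cases p)
  have ig: "i \<in> I" "g \<in> carrier (G i)" "g \<noteq> \<one>\<^bsub>G i\<^esub>" "u \<in> reduced_words I G"
    using Cons.prems by (auto simp: p reduced_words_Cons)
  interpret group "G i" using groups ig(1) .
  obtain v where v: "v \<in> reduced_words I G" "foldr (syllable_mult G) v u = []"
    using Cons.IH ig by blast
  have one: "inv\<^bsub>G i\<^esub> g \<noteq> \<one>\<^bsub>G i\<^esub>"
    using ig by simp
  have s: "[(i, inv\<^bsub>G i\<^esub> g)] \<in> reduced_words I G"
    using ig one by (simp add: reduced_words_Cons)
  let ?v = "foldr (syllable_mult G) v [(i, inv\<^bsub>G i\<^esub> g)]"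
  have "foldr (syllable_mult G) ?v (p # u) = foldr (syllable_mult G) v u"
    using ig by (subst foldr_syllable_mult_assoc[OF v(1) s Cons.prems]) (simp add: p)
  then show ?case
    using v s foldr_syllable_mult_closed by metis
qed

lemma group_free_product: "group (free_product I G)"
  by (rule groupI)
    (auto simp: free_product_def foldr_syllable_mult_closed foldr_syllable_mult_assoc
      free_product_left_inverse)

lemma free_product_embed_hom:
  assumes "i \<in> I"
  shows "free_product_embed G i \<in> hom (G i) (free_product I G)"
proof (rule homI)
  fix g assume "g \<in> carrier (G i)"
  then show "free_product_embed G i g \<in> carrier (free_product I G)"
    using assms by (auto simp: free_product_def free_product_embed_def reduced_words_Cons)
next
  fix g h assume gh: "g \<in> carrier (G i)" "h \<in> carrier (G i)"
  interpret group "G i" using groups assms .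
  show "free_product_embed G i (g \<otimes>\<^bsub>G i\<^esub> h) =
        free_product_embed G i g \<otimes>\<^bsub>free_product I G\<^esub> free_product_embed G i h"
    using gh by (auto simp: free_product_def free_product_embed_def)
qed

lemma free_product_extend:
  assumes "group K" and f: "\<And>i. i \<in> I \<Longrightarrow> f i \<in> hom (G i) K"
  shows "\<exists>h \<in> hom (free_product I G) K. \<forall>i \<in> I. \<forall>g \<in> carrier (G i). h (free_product_embed G i g) = f i g"
proof -
  interpret K: group K by fact
  define h where "h w = foldr (\<lambda>(i, g) x. f i g \<otimes>\<^bsub>K\<^esub> x) w \<one>\<^bsub>K\<^esub>" for w
  have f_closed: "f i g \<in> carrier K" if "i \<in> I" "g \<in> carrier (G i)" for i g
    using f[OF that(1)] that(2) by (auto simp: hom_def)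
  have f_one: "f i \<one>\<^bsub>G i\<^esub> = \<one>\<^bsub>K\<^esub>" if "i \<in> I" for i
    using hom_one[OF f groups] that assms(1) by blast
  have f_mult: "f i (g \<otimes>\<^bsub>G i\<^esub> k) = f i g \<otimes>\<^bsub>K\<^esub> f i k"
    if "i \<in> I" "g \<in> carrier (G i)" "k \<in> carrier (G i)" for i g k
    using hom_mult[OF f] that by blast
  have h_Nil: "h [] = \<one>\<^bsub>K\<^esub>" and h_Cons: "h ((i, g) # w) = f i g \<otimes>\<^bsub>K\<^esub> h w" for i g w
    by (simp_all add: h_def)
  have h_closed: "h w \<in> carrier K" if "w \<in> reduced_words I G" for w
    using that by (induction w) (auto simp: reduced_words_Cons h_Nil h_Cons f_closed)
  have h_syllable: "h (syllable_mult G (i, g) w) = f i g \<otimes>\<^bsub>K\<^esub> h w"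
    if "i \<in> I" "g \<in> carrier (G i)" "w \<in> reduced_words I G" for i g w
  proof (cases w)
    case Nil
    then show ?thesis using that by (auto simp: h_Nil h_Cons f_one f_closed)
  next
    case (Cons p v)
    obtain j k where p: "p = (j, k)" by (cases p)
    have jk: "j \<in> I" "k \<in> carrier (G j)" "v \<in> reduced_words I G"
      using that(3) by (auto simp: Cons p reduced_words_Cons)
    show ?thesis
    proof (cases "i = j")
      case True
      then have k: "k \<in> carrier (G i)" using jk by simp
      have fgk: "f i g \<otimes>\<^bsub>K\<^esub> (f i k \<otimes>\<^bsub>K\<^esub> h v) = f i (g \<otimes>\<^bsub>G i\<^esub> k) \<otimes>\<^bsub>K\<^esub> h v"
        using that k jk by (simp add: f_mult f_closed h_closed K.m_assoc)
      show ?thesis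
      proof (cases "g \<otimes>\<^bsub>G i\<^esub> k = \<one>\<^bsub>G i\<^esub>")
        case one: True
        then have "f i g \<otimes>\<^bsub>K\<^esub> (f i k \<otimes>\<^bsub>K\<^esub> h v) = h v"
          using fgk that jk by (simp add: f_one h_closed)
        then show ?thesis using True one by (simp add: Cons p h_Cons)
      next
        case False
        then show ?thesis using True fgk by (simp add: Cons p h_Cons)
      qed
    next
      case False
      then show ?thesis
        using that jk by (auto simp: Cons p h_Cons f_one f_closed h_closed)
    qed
  qed
  have h_mult: "h (foldr (syllable_mult G) u v) = h u \<otimes>\<^bsub>K\<^esub> h v"
    if "u \<in> reduced_words I G" "v \<in> reduced_words I G" for u v
    using that
    by (induction u)
      (auto simp: reduced_words_Cons h_Nil h_Cons h_closed h_syllable f_closed K.m_assoc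
        foldr_syllable_mult_closed)
  have "h \<in> hom (free_product I G) K"
    by (rule homI) (auto simp: free_product_def h_closed h_mult)
  moreover have "h (free_product_embed G i g) = f i g" if "i \<in> I" "g \<in> carrier (G i)" for i g
    using h_syllable[OF that reduced_words_Nil] f_closed[OF that]
    by (simp add: free_product_embed_def h_Nil)
  ultimately show ?thesis by blast
qed

lemma free_product_extend_unique:
  assumes "group K" "h \<in> hom (free_product I G) K" "h' \<in> hom (free_product I G) K"
    and eq: "\<And>i g. i \<in> I \<Longrightarrow> g \<in> carrier (G i) \<Longrightarrow>
      h (free_product_embed G i g) = h' (free_product_embed G i g)"
    and "w \<in> carrier (free_product I G)"
  shows "h w = h' w"
proof -
  have "w \<in> reduced_words I G" using assms(5) by (simp add: free_product_def)
  then show ?thesis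
  proof (induction w)
    case Nil
    show ?case
      using hom_one[OF assms(2) group_free_product assms(1)]
        hom_one[OF assms(3) group_free_product assms(1)]
      by (simp add: free_product_def)
  next
    case (Cons p w)
    obtain i g where p: "p = (i, g)" by (cases p)
    have ig: "i \<in> I" "g \<in> carrier (G i)" "g \<noteq> \<one>\<^bsub>G i\<^esub>" "w \<in> reduced_words I G"
      "w = [] \<or> fst (hd w) \<noteq> i"
      using Cons.prems by (auto simp: p reduced_words_Cons)
    have s: "p # w = free_product_embed G i g \<otimes>\<^bsub>free_product I G\<^esub> w"
      using ig by (cases w) (auto simp: free_product_def free_product_embed_def p)
    have c: "free_product_embed G i g \<in> carrier (free_product I G)" "w \<in> carrier (free_product I G)"
      using ig by (auto simp: free_product_def free_product_embed_def reduced_words_Cons)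
    show ?case
      using hom_mult[OF assms(2) c] hom_mult[OF assms(3) c] eq[OF ig(1,2)] Cons.IH[OF ig(4)]
      by (simp add: s)
  qed
qed

end

end

theory Submission
  imports Defs
begin

text \<open>
  A group is a CSA-group iff centralizers of nontrivial elements are abelian and a nontrivial
  \<open>a\<close> that commutes with its conjugate by \<open>x\<close> commutes with \<open>x\<close>. Both conditions are checked in
  the free product for one element \<open>a\<close> at a time, up to conjugation. If \<open>a\<close> is a single
  syllable, its centralizer lies in the factor and the conditions are inherited. Otherwise \<open>a\<close>
  can be taken to be a cyclically reduced word \<open>u\<close>; multiplying an element of its centralizer by a
  high power of \<open>u\<close> gives a word that commutes with \<open>u\<close> as a list, so the centralizer is
  abelian and each of its elements has a positive power in \<open>\<langle>u\<rangle>\<close>. If the conjugate of \<open>u\<close> by \<open>x\<close>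
  commutes with \<open>u\<close>, comparing lengths shows that conjugation by \<open>x\<close> sends some power of \<open>u\<close> to
  itself or to its inverse. In both cases \<open>x\<^sup>2\<close> commutes with this power, and since there are no
  elements of order 2, commutation passes from \<open>x\<^sup>2\<close> to \<open>x\<close>.
\<close>

section \<open>CSA-groups through commutation\<close>

definition centralizer_abelian_at :: "('a, 'b) monoid_scheme \<Rightarrow> 'a \<Rightarrow> bool" where
  "centralizer_abelian_at G a \<longleftrightarrow>
     (\<forall>x \<in> carrier G. \<forall>y \<in> carrier G.
        a \<otimes>\<^bsub>G\<^esub> x = x \<otimes>\<^bsub>G\<^esub> a \<longrightarrow> a \<otimes>\<^bsub>G\<^esub> y = y \<otimes>\<^bsub>G\<^esub> a \<longrightarrow> x \<otimes>\<^bsub>G\<^esub> y = y \<otimes>\<^bsub>G\<^esub> x)"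

definition conjugates_separated_at :: "('a, 'b) monoid_scheme \<Rightarrow> 'a \<Rightarrow> bool" where
  "conjugates_separated_at G a \<longleftrightarrow>
     (\<forall>x \<in> carrier G.
        a \<otimes>\<^bsub>G\<^esub> (inv\<^bsub>G\<^esub> x \<otimes>\<^bsub>G\<^esub> a \<otimes>\<^bsub>G\<^esub> x) = (inv\<^bsub>G\<^esub> x \<otimes>\<^bsub>G\<^esub> a \<otimes>\<^bsub>G\<^esub> x) \<otimes>\<^bsub>G\<^esub> a \<longrightarrow>
        a \<otimes>\<^bsub>G\<^esub> x = x \<otimes>\<^bsub>G\<^esub> a)"

context group
begin

section \<open>Abelian subgroups, commuting elements and maximal abelian subgroups\<close>

lemma abelian_subgroup_iff:
  "abelian_subgroup G A \<longleftrightarrow> subgroup A G \<and> (\<forall>x\<in>A. \<forall>y\<in>A. x \<otimes> y = y \<otimes> x)"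
proof -
  have "x \<otimes> y = y \<otimes> x" if "comm_group (G\<lparr>carrier := A\<rparr>)" "x \<in> A" "y \<in> A" for x y
    using comm_monoid.m_comm[OF comm_group.axioms(1)[OF that(1)]] that(2,3) by simp
  moreover have "comm_group (G\<lparr>carrier := A\<rparr>)"
    if "subgroup A G" "\<forall>x\<in>A. \<forall>y\<in>A. x \<otimes> y = y \<otimes> x"
    using group.group_comm_groupI[OF subgroup_imp_group[OF that(1)]] that(2) by simp
  ultimately show ?thesis
    unfolding abelian_subgroup_def by blast
qed

lemma commute_mult:
  assumes "x \<in> carrier G" "y \<in> carrier G" "z \<in> carrier G"
    and "x \<otimes> z = z \<otimes> x" "y \<otimes> z = z \<otimes> y"
  shows "(x \<otimes> y) \<otimes> z = z \<otimes> (x \<otimes> y)"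
  by (metis assms m_assoc)

lemma commute_inv:
  assumes "x \<in> carrier G" "z \<in> carrier G" "x \<otimes> z = z \<otimes> x"
  shows "inv x \<otimes> z = z \<otimes> inv x"
  by (metis assms inv_closed inv_solve_left inv_solve_right m_assoc m_closed)

lemma commute_nat_pow:
  assumes "x \<in> carrier G" "z \<in> carrier G" "x \<otimes> z = z \<otimes> x"
  shows "x [^] (n::nat) \<otimes> z = z \<otimes> x [^] n"
  by (induction n) (use assms in \<open>auto intro: commute_mult\<close>)

text \<open>Zorn's lemma is applied to pairwise commuting subsets rather than to subgroups, so that
  unions of chains need no closure argument. A maximal such set contains every element commuting
  with all of it, and this makes it a subgroup.\<close>

lemma ex_maximal_abelian_subgroup:
  assumes A: "A \<subseteq> carrier G" "\<forall>x\<in>A. \<forall>y\<in>A. x \<otimes> y = y \<otimes> x"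
  shows "\<exists>M. maximal_abelian_subgroup G M \<and> A \<subseteq> M"
proof -
  define S where "S = {X. A \<subseteq> X \<and> X \<subseteq> carrier G \<and> (\<forall>x\<in>X. \<forall>y\<in>X. x \<otimes> y = y \<otimes> x)}"
  have "A \<in> S"
    using assms by (auto simp: S_def)
  moreover have "\<Union>C \<in> S" if "C \<noteq> {}" "subset.chain S C" for C
  proof -
    have C: "C \<subseteq> S" "X \<subseteq> Y \<or> Y \<subseteq> X" if "X \<in> C" "Y \<in> C" for X Y
      using \<open>subset.chain S C\<close> that by (auto simp: subset_chain_def)
    have "x \<otimes> y = y \<otimes> x" if xy: "x \<in> \<Union>C" "y \<in> \<Union>C" for x y
    proof -
      obtain X Y where "X \<in> C" "x \<in> X" "Y \<in> C" "y \<in> Y" using xy by blast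
      then obtain Z where "Z \<in> C" "x \<in> Z" "y \<in> Z" using C by (metis subsetD)
      then show ?thesis using C(1)[of Z Z] by (auto simp: S_def)
    qed
    moreover have "A \<subseteq> \<Union>C" "\<Union>C \<subseteq> carrier G"
      using that C unfolding S_def by blast+
    ultimately show ?thesis by (simp add: S_def)
  qed
  ultimately obtain M where M: "M \<in> S" and max: "\<And>X. X \<in> S \<Longrightarrow> M \<subseteq> X \<Longrightarrow> X = M"
    using subset_Zorn_nonempty[of S] by blast
  have M_carrier: "M \<subseteq> carrier G" and M_comm: "\<And>x y. x \<in> M \<Longrightarrow> y \<in> M \<Longrightarrow> x \<otimes> y = y \<otimes> x"
    and AM: "A \<subseteq> M"
    using M by (auto simp: S_def)
  have M_cent: "z \<in> M" if "z \<in> carrier G" "\<And>x. x \<in> M \<Longrightarrow> z \<otimes> x = x \<otimes> z" for z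
  proof -
    have "insert z M \<in> S"
      using M that by (auto simp: S_def)
    then show ?thesis using max[of "insert z M"] by blast
  qed
  have "subgroup M G"
  proof (rule subgroupI)
    show "inv x \<in> M" if "x \<in> M" for x
      using that M_carrier M_comm commute_inv by (intro M_cent) (auto simp: subset_iff)
    show "x \<otimes> y \<in> M" if "x \<in> M" "y \<in> M" for x y
      using that M_carrier M_comm commute_mult by (intro M_cent) (auto simp: subset_iff)
    show "M \<noteq> {}" using M_cent[of \<one>] M_carrier by auto
  qed (use M_carrier in auto)
  moreover have "B = M" if "abelian_subgroup G B" "M \<subseteq> B" for B
    using that AM max[of B] subgroup.subset[of B G]
    by (auto simp: abelian_subgroup_iff S_def)
  ultimately show ?thesis
    using M_comm AM unfolding maximal_abelian_subgroup_def abelian_subgroup_iff by blast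
qed

lemma ex_maximal_abelian_subgroup_pair:
  assumes "a \<in> carrier G" "b \<in> carrier G" and ab: "a \<otimes> b = b \<otimes> a"
  shows "\<exists>M. maximal_abelian_subgroup G M \<and> a \<in> M \<and> b \<in> M"
proof -
  have "\<forall>x\<in>{a, b}. \<forall>y\<in>{a, b}. x \<otimes> y = y \<otimes> x"
    using ab by (metis insertE singletonD)
  then show ?thesis
    using ex_maximal_abelian_subgroup[of "{a, b}"] assms(1,2) by (metis insert_subset empty_subsetI)
qed

text \<open>The form in which malnormality is applied: if \<open>x\<close> were outside
  \<open>M\<close>, the conjugate of \<open>a\<close> would lie in the trivial intersection of
  \<open>M\<close> with its conjugate by \<open>x\<close>.\<close>

lemma CSA_group_conj_mem:
  assumes "CSA_group G" "maximal_abelian_subgroup G M"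
    and "a \<in> M" "a \<noteq> \<one>" "x \<in> carrier G" "inv x \<otimes> a \<otimes> x \<in> M"
  shows "x \<in> M"
proof (rule ccontr)
  assume "x \<notin> M"
  have M: "subgroup M G" and sep: "M \<inter> conjugate_subgroup G M x = {\<one>}"
    using assms \<open>x \<notin> M\<close> by (auto simp: CSA_group_def conjugately_separated_def)
  have a: "a \<in> carrier G"
    using subgroup.mem_carrier[OF M assms(3)] .
  have "inv x \<otimes> a \<otimes> x = \<one>"
    using sep assms(3,6) by (auto simp: conjugate_subgroup_def)
  then have "a = \<one>"
    using a assms(5) by (metis inv_closed inv_solve_left' m_closed r_one right_cancel)
  then show False using assms(4) by simp
qed

lemma CSA_group_iff:
  "CSA_group G \<longleftrightarrow>
     (\<forall>a \<in> carrier G. a \<noteq> \<one> \<longrightarrow> centralizer_abelian_at G a \<and> conjugates_separated_at G a)"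
proof (intro iffI ballI impI conjI)
  fix a assume CSA: "CSA_group G" and a: "a \<in> carrier G" "a \<noteq> \<one>"
  show "centralizer_abelian_at G a"
    unfolding centralizer_abelian_at_def
  proof (intro ballI impI)
    fix x y assume xy: "x \<in> carrier G" "y \<in> carrier G" "a \<otimes> x = x \<otimes> a" "a \<otimes> y = y \<otimes> a"
    obtain M where M: "maximal_abelian_subgroup G M" "a \<in> M" "x \<in> M"
      using ex_maximal_abelian_subgroup_pair[OF a(1) xy(1,3)] by blast
    \<comment> \<open>An element centralizing \<open>a\<close> conjugates \<open>a\<close> to
      itself, so malnormality puts it into the \<open>M\<close> chosen for \<open>a\<close> and
      \<open>x\<close>.\<close>
    have "inv y \<otimes> a \<otimes> y = a"
      using a xy by (metis inv_solve_left m_assoc m_closed inv_closed)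
    then have "y \<in> M"
      using CSA_group_conj_mem[OF CSA M(1,2) a(2) xy(2)] M by simp
    then show "x \<otimes> y = y \<otimes> x"
      using M by (simp add: maximal_abelian_subgroup_def abelian_subgroup_iff)
  qed
  show "conjugates_separated_at G a"
    unfolding conjugates_separated_at_def
  proof (intro ballI impI)
    fix x assume x: "x \<in> carrier G"
      and ax: "a \<otimes> (inv x \<otimes> a \<otimes> x) = inv x \<otimes> a \<otimes> x \<otimes> a"
    have "inv x \<otimes> a \<otimes> x \<in> carrier G" using a x by simp
    then obtain M where M: "maximal_abelian_subgroup G M" "a \<in> M" "inv x \<otimes> a \<otimes> x \<in> M"
      using ex_maximal_abelian_subgroup_pair[OF a(1) _ ax] a x by blast
    then have "x \<in> M"
      using CSA_group_conj_mem[OF CSA M(1,2) a(2) x] by simp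
    then show "a \<otimes> x = x \<otimes> a"
      using M by (simp add: maximal_abelian_subgroup_def abelian_subgroup_iff)
  qed
next
  assume at: "\<forall>a \<in> carrier G. a \<noteq> \<one> \<longrightarrow> centralizer_abelian_at G a \<and> conjugates_separated_at G a"
  have "conjugately_separated G M" if max: "maximal_abelian_subgroup G M" for M
  proof -
    have M: "subgroup M G" and comm: "\<And>x y. x \<in> M \<Longrightarrow> y \<in> M \<Longrightarrow> x \<otimes> y = y \<otimes> x"
      using max by (auto simp: maximal_abelian_subgroup_def abelian_subgroup_iff)
    note M_carrier = subgroup.mem_carrier[OF M]
    have "x \<in> M" if x: "x \<in> carrier G" and h: "h \<in> M" "inv x \<otimes> h \<otimes> x \<in> M" "h \<noteq> \<one>" for x h
    proof -
      have hx: "h \<otimes> x = x \<otimes> h"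
        using at[rule_format, OF M_carrier[OF h(1)] h(3)] comm[OF h(1,2)] x
        unfolding conjugates_separated_at_def by blast
      \<comment> \<open>Both \<open>y\<close> and \<open>x\<close> centralize the nontrivial
        \<open>h\<close>. Hence \<open>x\<close> commutes with all of \<open>M\<close>, and
        maximality absorbs it.\<close>
      have "y \<otimes> x = x \<otimes> y" if "y \<in> M" for y
        using at[rule_format, OF M_carrier[OF h(1)] h(3)] comm[OF h(1) that] hx x M_carrier[OF that]
        unfolding centralizer_abelian_at_def by blast
      then have "\<forall>y\<in>insert x M. \<forall>z\<in>insert x M. y \<otimes> z = z \<otimes> y"
        using comm by (metis insertE)
      then obtain N where N: "maximal_abelian_subgroup G N" "insert x M \<subseteq> N"
        using ex_maximal_abelian_subgroup[of "insert x M"] x M_carrier by blast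
      then have "N = M"
        using max by (simp add: maximal_abelian_subgroup_def)
      then show ?thesis
        using N by simp
    qed
    note mem = this
    have "M \<inter> conjugate_subgroup G M x = {\<one>}" if x: "x \<in> carrier G - M" for x
    proof -
      have "inv x \<otimes> \<one> \<otimes> x = \<one>" using x by simp
      then have "\<one> \<in> M \<inter> conjugate_subgroup G M x"
        using subgroup.one_closed[OF M] unfolding conjugate_subgroup_def by (metis IntI image_eqI)
      moreover have "k = \<one>" if k: "k \<in> M \<inter> conjugate_subgroup G M x" for k
      proof -
        obtain h where h: "h \<in> M" "k = inv x \<otimes> h \<otimes> x" "k \<in> M"
          using k by (auto simp: conjugate_subgroup_def)
        have "h = \<one>"
          using mem[of x h] h x by blast
        then show ?thesis
          using h x by simp
      qed
      ultimately show ?thesis by blast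
    qed
    then show ?thesis
      using M by (simp add: conjugately_separated_def)
  qed
  then show "CSA_group G"
    by (simp add: CSA_group_def group_axioms)
qed

section \<open>Invariance of the commutation conditions under conjugation\<close>

lemma conj_mult:
  assumes "c \<in> carrier G" "x \<in> carrier G" "y \<in> carrier G"
  shows "inv c \<otimes> (x \<otimes> y) \<otimes> c = (inv c \<otimes> x \<otimes> c) \<otimes> (inv c \<otimes> y \<otimes> c)"
proof -
  have "c \<otimes> (inv c \<otimes> (y \<otimes> c)) = y \<otimes> c"
    using assms by (simp flip: m_assoc)
  then show ?thesis
    using assms by (simp add: m_assoc)
qed

lemma conj_eq_iff:
  assumes "c \<in> carrier G" "x \<in> carrier G" "y \<in> carrier G"
  shows "inv c \<otimes> x \<otimes> c = inv c \<otimes> y \<otimes> c \<longleftrightarrow> x = y"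
  using assms by simp

lemma conj_inv:
  assumes "c \<in> carrier G" "x \<in> carrier G"
  shows "inv c \<otimes> inv x \<otimes> c = inv (inv c \<otimes> x \<otimes> c)"
  using assms by (simp add: inv_mult_group m_assoc)

lemma conj_nat_pow:
  assumes "c \<in> carrier G" "x \<in> carrier G"
  shows "(inv c \<otimes> x \<otimes> c) [^] (n::nat) = inv c \<otimes> x [^] n \<otimes> c"
  by (induction n) (use assms in \<open>auto simp: conj_mult\<close>)

lemma conj_one_iff:
  assumes "c \<in> carrier G" "x \<in> carrier G"
  shows "inv c \<otimes> x \<otimes> c = \<one> \<longleftrightarrow> x = \<one>"
  using conj_eq_iff[of c x \<one>] assms by simp

lemma conj_commute_iff:
  assumes "c \<in> carrier G" "x \<in> carrier G" "y \<in> carrier G"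
  shows "(inv c \<otimes> x \<otimes> c) \<otimes> (inv c \<otimes> y \<otimes> c) = (inv c \<otimes> y \<otimes> c) \<otimes> (inv c \<otimes> x \<otimes> c) \<longleftrightarrow>
    x \<otimes> y = y \<otimes> x"
  using assms by (simp flip: conj_mult)

text \<open>Conjugation by \<open>c\<close> is injective and multiplicative, so commutation
  relations can be moved to the conjugates and back.\<close>

lemma centralizer_abelian_at_conj:
  assumes a: "a \<in> carrier G" and c: "c \<in> carrier G"
    and conj: "centralizer_abelian_at G (inv c \<otimes> a \<otimes> c)"
  shows "centralizer_abelian_at G a"
  unfolding centralizer_abelian_at_def
proof (intro ballI impI)
  fix x y assume xy: "x \<in> carrier G" "y \<in> carrier G" "a \<otimes> x = x \<otimes> a" "a \<otimes> y = y \<otimes> a"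
  have cl: "inv c \<otimes> x \<otimes> c \<in> carrier G" "inv c \<otimes> y \<otimes> c \<in> carrier G"
    using c xy by simp_all
  show "x \<otimes> y = y \<otimes> x"
    using conj[unfolded centralizer_abelian_at_def, rule_format, OF cl]
    unfolding conj_commute_iff[OF c a xy(1)] conj_commute_iff[OF c a xy(2)] conj_commute_iff[OF c xy(1,2)]
    using xy(3,4) by blast
qed

lemma conjugates_separated_at_conj:
  assumes a: "a \<in> carrier G" and c: "c \<in> carrier G"
    and conj: "conjugates_separated_at G (inv c \<otimes> a \<otimes> c)"
  shows "conjugates_separated_at G a"
  unfolding conjugates_separated_at_def
proof (intro ballI impI)
  fix x assume x: "x \<in> carrier G" and ax: "a \<otimes> (inv x \<otimes> a \<otimes> x) = inv x \<otimes> a \<otimes> x \<otimes> a"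
  define \<phi> where "\<phi> y = inv c \<otimes> y \<otimes> c" for y
  have hom: "\<phi> (y \<otimes> z) = \<phi> y \<otimes> \<phi> z" "\<phi> (inv y) = inv (\<phi> y)" "\<phi> y \<in> carrier G"
    if "y \<in> carrier G" "z \<in> carrier G" for y z
    using that c by (simp_all add: \<phi>_def conj_mult conj_inv)
  have ix: "inv x \<otimes> a \<otimes> x \<in> carrier G" using a x by simp
  have "\<phi> a \<otimes> \<phi> (inv x \<otimes> a \<otimes> x) = \<phi> (inv x \<otimes> a \<otimes> x) \<otimes> \<phi> a"
    using ax hom(1)[OF a ix] hom(1)[OF ix a] by simp
  then have "\<phi> a \<otimes> \<phi> x = \<phi> x \<otimes> \<phi> a"
    using conj[folded \<phi>_def, unfolded conjugates_separated_at_def, rule_format, of "\<phi> x"] a x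
    by (simp add: hom)
  then show "a \<otimes> x = x \<otimes> a"
    using conj_commute_iff[OF c a x] by (simp add: \<phi>_def)
qed

lemma ord_two_iff:
  assumes "x \<in> carrier G"
  shows "ord x = 2 \<longleftrightarrow> x \<otimes> x = \<one> \<and> x \<noteq> \<one>"
proof -
  have "x \<otimes> x = x [^] (2::nat)"
    using assms by (simp add: numeral_2_eq_2)
  then have "x \<otimes> x = \<one> \<longleftrightarrow> ord x dvd 2"
    using assms pow_eq_id by simp
  moreover have "ord x = 1 \<or> ord x = 2" if "ord x dvd 2"
    using dvd_imp_le[OF that] that by (cases "ord x = 0") auto
  ultimately show ?thesis
    using ord_eq_1[OF assms] by auto
qed

lemma CSA_star_group_iff:
  "CSA_star_group G \<longleftrightarrow>
     (\<forall>a \<in> carrier G. a \<noteq> \<one> \<longrightarrow>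
        centralizer_abelian_at G a \<and> conjugates_separated_at G a \<and> a \<otimes> a \<noteq> \<one>)"
  using ord_two_iff unfolding CSA_star_group_def CSA_group_iff by blast

end

section \<open>Reduced words\<close>

lemma length_syllable_mult_le: "length (syllable_mult G s w) \<le> Suc (length w)"
  by (cases "(G, s, w)" rule: syllable_mult.cases) auto

lemma length_le_Suc_syllable_mult: "length w \<le> Suc (length (syllable_mult G s w))"
  by (cases "(G, s, w)" rule: syllable_mult.cases) auto

text \<open>Growth by one syllable rules out merging, deletion and a trivial factor.\<close>

lemma syllable_mult_eq_Cons:
  "length (syllable_mult G s w) = Suc (length w) \<Longrightarrow> syllable_mult G s w = s # w"
  by (cases "(G, s, w)" rule: syllable_mult.cases) (auto split: if_splits)

lemma syllable_mult_append:
  "w \<noteq> [] \<Longrightarrow> syllable_mult G s (w @ v) = syllable_mult G s w @ v"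
  by (cases "(G, s, w)" rule: syllable_mult.cases) auto

lemma length_foldr_syllable_mult_le:
  "length (foldr (syllable_mult G) u v) \<le> length u + length v"
proof (induction u)
  case (Cons s u)
  then show ?case using length_syllable_mult_le[of G s "foldr (syllable_mult G) u v"] by simp
qed simp

lemma length_le_foldr_syllable_mult:
  "length v \<le> length u + length (foldr (syllable_mult G) u v)"
proof (induction u)
  case (Cons s u)
  then show ?case using length_le_Suc_syllable_mult[of "foldr (syllable_mult G) u v" G s] by simp
qed simp

text \<open>Every syllable of \<open>u\<close> adds at most one to the length, so reaching the full
  length forces each step to be a plain \<open>Cons\<close>. This turns a length count into an
  equality of lists.\<close>

lemma foldr_syllable_mult_eq_append:
  "length (foldr (syllable_mult G) u v) = length u + length v \<Longrightarrow> foldr (syllable_mult G) u v = u @ v"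
proof (induction u)
  case (Cons s u)
  let ?w = "foldr (syllable_mult G) u v"
  have "length ?w = length u + length v"
    using Cons.prems length_syllable_mult_le[of G s ?w] length_foldr_syllable_mult_le[of G u v]
    by simp
  then show ?case
    using Cons syllable_mult_eq_Cons[of G s ?w] by simp
qed simp

text \<open>Each syllable of \<open>u\<close> consumes at most one syllable of \<open>v\<close>.
  Before each step something of \<open>v\<close> is therefore left, and it shields
  \<open>w\<close>.\<close>

lemma foldr_syllable_mult_append:
  "length u \<le> length v \<Longrightarrow> foldr (syllable_mult G) u (v @ w) = foldr (syllable_mult G) u v @ w"
proof (induction u)
  case (Cons s u)
  then have "foldr (syllable_mult G) u v \<noteq> []"
    using length_le_foldr_syllable_mult[of v u G] by auto
  then show ?case
    using Cons by (simp add: syllable_mult_append)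
qed simp

lemma reduced_words_append:
  "u @ v \<in> reduced_words I G \<longleftrightarrow>
     u \<in> reduced_words I G \<and> v \<in> reduced_words I G \<and> (u = [] \<or> v = [] \<or> fst (last u) \<noteq> fst (hd v))"
  by (auto simp: reduced_words_def distinct_adj_append_iff last_map hd_map)

section \<open>Commuting lists\<close>

lemma concat_replicate_concat_replicate:
  "concat (replicate m (concat (replicate n xs))) = concat (replicate (m * n) xs)"
  by (induction m) (simp_all add: replicate_add)

text \<open>A list commuting with \<open>u\<close> commutes with all powers of \<open>u\<close>,
  hence is a prefix of a high power and is determined by its length. Both \<open>x @ y\<close> and
  \<open>y @ x\<close> are such prefixes, of equal length.\<close>

lemma comm_append_trans:
  assumes "u \<noteq> []" "x @ u = u @ x" "y @ u = u @ y"
  shows "x @ y = y @ x"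
proof -
  have prefix: "z = take (length z) (concat (replicate k u))"
    if "z @ u = u @ z" "length z \<le> k" for z k
  proof -
    have "z @ concat (replicate k u) = concat (replicate k u) @ z" for k
    proof (induction k)
      case (Suc k)
      have "z @ concat (replicate (Suc k) u) = u @ (z @ concat (replicate k u))"
        using that(1) by (metis append_assoc concat.simps(2) replicate_Suc)
      then show ?case using Suc by simp
    qed simp
    then have "z = take (length z) (concat (replicate k u) @ z)"
      by (metis append_eq_conv_conj)
    \<comment> \<open>Since \<open>u\<close> is nonempty, \<open>k\<close> copies are long enough to
      contain the prefix of length \<open>length z\<close>.\<close>
    moreover have "k \<le> length (concat (replicate k u))"
      using \<open>u \<noteq> []\<close> by (cases u) (auto simp: length_concat sum_list_replicate)
    ultimately show ?thesis
      using that(2) by simp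
  qed
  have "(x @ y) @ u = u @ (x @ y)" "(y @ x) @ u = u @ (y @ x)"
    using assms(2,3) by (metis append_assoc)+
  then show ?thesis
    using prefix[of "x @ y" "length x + length y"] prefix[of "y @ x" "length x + length y"]
    by (metis add.commute length_append order_refl)
qed

section \<open>Commutation in free products\<close>

locale group_family =
  fixes I :: "'i set" and G :: "'i \<Rightarrow> ('a, 'b) monoid_scheme"
  assumes groups: "\<And>i. i \<in> I \<Longrightarrow> group (G i)"
begin

abbreviation F where "F \<equiv> free_product I G"

sublocale F: group F
  by (rule group_free_product) (rule groups)

lemma carrier_F: "carrier F = reduced_words I G"
  and one_F: "\<one>\<^bsub>F\<^esub> = []"
  and mult_F: "u \<otimes>\<^bsub>F\<^esub> v = foldr (syllable_mult G) u v"
  by (simp_all add: free_product_def)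

section \<open>Products, inverses and lengths in the free product\<close>

lemma singleton_in_F: "[(i, g)] \<in> carrier F \<longleftrightarrow> i \<in> I \<and> g \<in> carrier (G i) \<and> g \<noteq> \<one>\<^bsub>G i\<^esub>"
  by (simp add: carrier_F reduced_words_Cons)

lemma append_eq_mult_F:
  assumes "u @ v \<in> carrier F"
  shows "u \<otimes>\<^bsub>F\<^esub> v = u @ v"
proof -
  have "v \<in> reduced_words I G"
    using assms by (simp add: carrier_F reduced_words_append)
  then have "foldr (syllable_mult G) u v = foldr (syllable_mult G) (u @ v) []"
    using foldr_syllable_mult_Nil[of I G, OF groups] by simp
  also have "\<dots> = u @ v"
    using foldr_syllable_mult_Nil[of I G "u @ v", OF groups] assms by (simp only: carrier_F)
  finally show ?thesis by (simp add: mult_F)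
qed

lemma length_mult_F_le: "length (u \<otimes>\<^bsub>F\<^esub> v) \<le> length u + length v"
  by (simp add: mult_F length_foldr_syllable_mult_le)

lemma inv_F_singleton:
  assumes "[(i, g)] \<in> carrier F"
  shows "inv\<^bsub>F\<^esub> [(i, g)] = [(i, inv\<^bsub>G i\<^esub> g)]"
proof -
  interpret Gi: group "G i" using groups assms by (simp add: singleton_in_F)
  have "[(i, inv\<^bsub>G i\<^esub> g)] \<otimes>\<^bsub>F\<^esub> [(i, g)] = \<one>\<^bsub>F\<^esub>" "[(i, inv\<^bsub>G i\<^esub> g)] \<in> carrier F"
    using assms by (auto simp: singleton_in_F mult_F one_F)
  then show ?thesis
    using F.inv_equality assms by blast
qed

lemma length_inv_F:
  assumes "u \<in> carrier F"
  shows "length (inv\<^bsub>F\<^esub> u) = length u"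
proof -
  \<comment> \<open>One inequality suffices: applied to the inverse of \<open>u\<close> as well, it
    gives equality.\<close>
  have le: "length (inv\<^bsub>F\<^esub> u) \<le> length u" if "u \<in> carrier F" for u
    using that
  proof (induction u)
    case Nil
    then show ?case using F.inv_one by (simp add: one_F)
  next
    case (Cons s u)
    obtain i g where s: "s = (i, g)" by (cases s)
    have su: "[s] \<in> carrier F" "u \<in> carrier F"
      using Cons.prems by (simp_all add: s carrier_F reduced_words_Cons)
    have "s # u = [s] \<otimes>\<^bsub>F\<^esub> u"
      using append_eq_mult_F[of "[s]" u] Cons.prems by simp
    then have "inv\<^bsub>F\<^esub> (s # u) = inv\<^bsub>F\<^esub> u \<otimes>\<^bsub>F\<^esub> inv\<^bsub>F\<^esub> [s]"
      using su by (simp add: F.inv_mult_group)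
    then show ?case
      using length_mult_F_le[of "inv\<^bsub>F\<^esub> u" "inv\<^bsub>F\<^esub> [s]"] Cons.IH[OF su(2)] inv_F_singleton su(1)
      by (simp add: s)
  qed
  from le[OF assms] le[of "inv\<^bsub>F\<^esub> u"] assms show ?thesis by simp
qed

subsection \<open>Elements conjugate into a factor\<close>

text \<open>If \<open>w\<close> does not start in factor \<open>i\<close>, the left product is the
  word \<open>(i, g) # w\<close>. By length the right product is then a plain append, and comparing
  first syllables forces \<open>w\<close> to be empty. A first syllable of \<open>w\<close> in
  factor \<open>i\<close> is stripped beforehand. Distinct \<open>g\<close> and \<open>g'\<close>
  are allowed in order to treat conjugation as well as centralizers.\<close>

lemma mult_F_singleton_cases:
  assumes "w \<in> carrier F" "[(i, g)] \<in> carrier F" "[(i, g')] \<in> carrier F"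
    and eq: "[(i, g)] \<otimes>\<^bsub>F\<^esub> w = w \<otimes>\<^bsub>F\<^esub> [(i, g')]"
  shows "w = [] \<or> (\<exists>h. w = [(i, h)])"
proof -
  \<comment> \<open>Here \<open>g\<close> is generalized because stripping the first syllable
    replaces it by a conjugate, while \<open>g'\<close> stays fixed.\<close>
  have Nil: "w = []"
    if w: "w \<in> carrier F" and hd: "w = [] \<or> fst (hd w) \<noteq> i"
      and g: "[(i, g)] \<in> carrier F" and eq: "[(i, g)] \<otimes>\<^bsub>F\<^esub> w = w \<otimes>\<^bsub>F\<^esub> [(i, g')]" for w g
  proof (rule ccontr)
    assume "w \<noteq> []"
    have "(i, g) # w \<in> carrier F"
      using w hd g by (auto simp: carrier_F reduced_words_Cons)
    then have left: "[(i, g)] \<otimes>\<^bsub>F\<^esub> w = (i, g) # w"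
      using append_eq_mult_F[of "[(i, g)]" w] by simp
    then have "length (w \<otimes>\<^bsub>F\<^esub> [(i, g')]) = Suc (length w)"
      using eq by (metis length_Cons)
    then have "w \<otimes>\<^bsub>F\<^esub> [(i, g')] = w @ [(i, g')]"
      using foldr_syllable_mult_eq_append[of G w "[(i, g')]"] by (simp add: mult_F)
    then have "hd w = (i, g)"
      using left eq \<open>w \<noteq> []\<close> by (metis hd_append2 list.sel(1))
    then show False
      using hd \<open>w \<noteq> []\<close> by simp
  qed
  show ?thesis
  proof (cases "w = [] \<or> fst (hd w) \<noteq> i")
    case True
    then show ?thesis using Nil assms by blast
  next
    case False
    then obtain h v where w: "w = (i, h) # v"
      by (cases w) auto
    have h: "[(i, h)] \<in> carrier F" and v: "v \<in> carrier F" "v = [] \<or> fst (hd v) \<noteq> i"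
      using assms(1) by (auto simp: w carrier_F reduced_words_Cons)
    have w_eq: "w = [(i, h)] \<otimes>\<^bsub>F\<^esub> v"
      using append_eq_mult_F[of "[(i, h)]" v] assms(1) by (simp add: w)
    interpret Gi: group "G i" using groups h by (simp add: singleton_in_F)
    \<comment> \<open>The conjugate of \<open>g\<close> by \<open>h\<close>, chosen so that
      \<open>g h = h k\<close> and \<open>h\<close> can be cancelled on the left.\<close>
    define k where "k = inv\<^bsub>G i\<^esub> h \<otimes>\<^bsub>G i\<^esub> (g \<otimes>\<^bsub>G i\<^esub> h)"
    have gh: "g \<in> carrier (G i)" "h \<in> carrier (G i)" "g \<noteq> \<one>\<^bsub>G i\<^esub>" "i \<in> I"
      using assms(2) h by (auto simp: singleton_in_F)
    have "k \<noteq> \<one>\<^bsub>G i\<^esub>"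
    proof
      assume "k = \<one>\<^bsub>G i\<^esub>"
      then have "g \<otimes>\<^bsub>G i\<^esub> h = h"
        using gh unfolding k_def by (metis Gi.inv_closed Gi.m_closed Gi.inv_equality Gi.inv_inv Gi.inv_comm)
      then show False using gh by simp
    qed
    then have k: "[(i, k)] \<in> carrier F"
      using gh by (simp add: singleton_in_F k_def)
    have "[(i, h)] \<otimes>\<^bsub>F\<^esub> [(i, k)] = [(i, g)] \<otimes>\<^bsub>F\<^esub> [(i, h)]"
      using gh \<open>k \<noteq> \<one>\<^bsub>G i\<^esub>\<close> by (auto simp: mult_F k_def simp flip: Gi.m_assoc)
    then have "[(i, h)] \<otimes>\<^bsub>F\<^esub> ([(i, k)] \<otimes>\<^bsub>F\<^esub> v) = [(i, h)] \<otimes>\<^bsub>F\<^esub> (v \<otimes>\<^bsub>F\<^esub> [(i, g')])"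
      using eq h k v(1) assms(2,3) by (metis F.m_assoc w_eq)
    then have "[(i, k)] \<otimes>\<^bsub>F\<^esub> v = v \<otimes>\<^bsub>F\<^esub> [(i, g')]"
      using h k v(1) assms(3) by simp
    then have "v = []"
      using Nil[OF v k] by blast
    then show ?thesis using w by simp
  qed
qed

lemma singleton_mult_F_commute_iff:
  assumes "[(i, g)] \<in> carrier F" "[(i, h)] \<in> carrier F"
  shows "[(i, g)] \<otimes>\<^bsub>F\<^esub> [(i, h)] = [(i, h)] \<otimes>\<^bsub>F\<^esub> [(i, g)] \<longleftrightarrow> g \<otimes>\<^bsub>G i\<^esub> h = h \<otimes>\<^bsub>G i\<^esub> g"
  using assms by (auto simp: mult_F)

lemma centralizer_abelian_at_singleton:
  assumes g: "[(i, g)] \<in> carrier F" and Gi: "centralizer_abelian_at (G i) g"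
  shows "centralizer_abelian_at F [(i, g)]"
  unfolding centralizer_abelian_at_def
proof (intro ballI impI)
  fix x y
  assume xy: "x \<in> carrier F" "y \<in> carrier F"
    and gx: "[(i, g)] \<otimes>\<^bsub>F\<^esub> x = x \<otimes>\<^bsub>F\<^esub> [(i, g)]" and gy: "[(i, g)] \<otimes>\<^bsub>F\<^esub> y = y \<otimes>\<^bsub>F\<^esub> [(i, g)]"
  show "x \<otimes>\<^bsub>F\<^esub> y = y \<otimes>\<^bsub>F\<^esub> x"
  proof (cases "x = \<one>\<^bsub>F\<^esub> \<or> y = \<one>\<^bsub>F\<^esub>")
    case True
    then show ?thesis using xy by auto
  next
    case False
    then obtain h k where hk: "x = [(i, h)]" "y = [(i, k)]"
      using mult_F_singleton_cases[OF xy(1) g g gx] mult_F_singleton_cases[OF xy(2) g g gy]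
      by (auto simp: one_F)
    have "h \<in> carrier (G i)" "k \<in> carrier (G i)"
      using xy by (auto simp: hk singleton_in_F)
    moreover have "g \<otimes>\<^bsub>G i\<^esub> h = h \<otimes>\<^bsub>G i\<^esub> g" "g \<otimes>\<^bsub>G i\<^esub> k = k \<otimes>\<^bsub>G i\<^esub> g"
      using gx gy xy g singleton_mult_F_commute_iff by (auto simp: hk)
    ultimately have "h \<otimes>\<^bsub>G i\<^esub> k = k \<otimes>\<^bsub>G i\<^esub> h"
      using Gi unfolding centralizer_abelian_at_def by blast
    then show ?thesis
      using xy singleton_mult_F_commute_iff by (simp add: hk)
  qed
qed

text \<open>The case lemma is used twice: first the conjugate \<open>v\<close>, commuting with the
  syllable, is itself a syllable of factor \<open>i\<close>; then \<open>g x = x v\<close> forces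
  \<open>x\<close> to be trivial or a syllable of that factor, where the hypothesis on
  \<open>g\<close> applies.\<close>

lemma conjugates_separated_at_singleton:
  assumes g: "[(i, g)] \<in> carrier F" and Gi: "conjugates_separated_at (G i) g"
  shows "conjugates_separated_at F [(i, g)]"
  unfolding conjugates_separated_at_def
proof (intro ballI impI)
  fix x
  assume x: "x \<in> carrier F"
  define v where "v = inv\<^bsub>F\<^esub> x \<otimes>\<^bsub>F\<^esub> [(i, g)] \<otimes>\<^bsub>F\<^esub> x"
  assume "[(i, g)] \<otimes>\<^bsub>F\<^esub> (inv\<^bsub>F\<^esub> x \<otimes>\<^bsub>F\<^esub> [(i, g)] \<otimes>\<^bsub>F\<^esub> x) =
    inv\<^bsub>F\<^esub> x \<otimes>\<^bsub>F\<^esub> [(i, g)] \<otimes>\<^bsub>F\<^esub> x \<otimes>\<^bsub>F\<^esub> [(i, g)]"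
  then have gv: "[(i, g)] \<otimes>\<^bsub>F\<^esub> v = v \<otimes>\<^bsub>F\<^esub> [(i, g)]"
    by (simp add: v_def)
  have v: "v \<in> carrier F" using g x by (simp add: v_def)
  have "v \<noteq> \<one>\<^bsub>F\<^esub>"
    using F.conj_one_iff[OF x g] unfolding v_def by (simp add: one_F)
  then obtain g' where g': "v = [(i, g')]"
    using mult_F_singleton_cases[OF v g g gv] by (auto simp: one_F)
  have gx: "[(i, g)] \<otimes>\<^bsub>F\<^esub> x = x \<otimes>\<^bsub>F\<^esub> v"
    using g x by (simp add: v_def flip: F.m_assoc)
  have "x = \<one>\<^bsub>F\<^esub> \<or> (\<exists>h. x = [(i, h)])"
    using mult_F_singleton_cases[OF x g] v gx by (simp add: g' one_F)
  then show "[(i, g)] \<otimes>\<^bsub>F\<^esub> x = x \<otimes>\<^bsub>F\<^esub> [(i, g)]"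
  proof
    assume "\<exists>h. x = [(i, h)]"
    then obtain h where h: "x = [(i, h)]" by blast
    interpret Gi: group "G i" using groups g by (simp add: singleton_in_F)
    have gh: "g \<in> carrier (G i)" "h \<in> carrier (G i)" "g' \<in> carrier (G i)" "g \<noteq> \<one>\<^bsub>G i\<^esub>"
      using g x v by (auto simp: h g' singleton_in_F)
    have "g \<otimes>\<^bsub>G i\<^esub> h = h \<otimes>\<^bsub>G i\<^esub> g'"
      using gx by (auto simp: h g' mult_F split: if_splits)
    then have "g' = inv\<^bsub>G i\<^esub> h \<otimes>\<^bsub>G i\<^esub> g \<otimes>\<^bsub>G i\<^esub> h"
      using gh by (simp add: Gi.m_assoc Gi.inv_solve_left)
    moreover have "g \<otimes>\<^bsub>G i\<^esub> g' = g' \<otimes>\<^bsub>G i\<^esub> g"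
      using gv singleton_mult_F_commute_iff g v by (simp add: g')
    ultimately have "g \<otimes>\<^bsub>G i\<^esub> h = h \<otimes>\<^bsub>G i\<^esub> g"
      using Gi gh(2) unfolding conjugates_separated_at_def by blast
    then show ?thesis
      using singleton_mult_F_commute_iff g x by (simp add: h)
  qed (use g in auto)
qed

subsection \<open>Cyclically reduced words\<close>

text \<open>Reducedness of \<open>u @ u\<close> combines that of \<open>u\<close> with the condition
  that the last and first syllables come from different factors. Single syllables are thereby
  excluded.\<close>

definition cyclically_reduced :: "('i \<times> 'a) list \<Rightarrow> bool" where
  "cyclically_reduced u \<longleftrightarrow> u \<noteq> [] \<and> u @ u \<in> reduced_words I G"

text \<open>Induction on length: if the first and last syllables share a factor, conjugating by the
  first one moves it to the end, where it merges with the last and shortens the word.\<close>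

lemma ex_conj_cyclically_reduced:
  assumes "a \<in> carrier F" "a \<noteq> \<one>\<^bsub>F\<^esub>"
  shows "\<exists>c \<in> carrier F. (\<exists>i g. inv\<^bsub>F\<^esub> c \<otimes>\<^bsub>F\<^esub> a \<otimes>\<^bsub>F\<^esub> c = [(i, g)]) \<or>
    cyclically_reduced (inv\<^bsub>F\<^esub> c \<otimes>\<^bsub>F\<^esub> a \<otimes>\<^bsub>F\<^esub> c)"
  using assms
proof (induction "length a" arbitrary: a rule: less_induct)
  case less
  obtain i g v where a: "a = (i, g) # v"
    using less.prems by (cases a) (auto simp: one_F)
  have g: "[(i, g)] \<in> carrier F" and v: "v \<in> carrier F"
    using less.prems by (auto simp: a carrier_F reduced_words_Cons)
  have a_eq: "a = [(i, g)] \<otimes>\<^bsub>F\<^esub> v"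
    using append_eq_mult_F[of "[(i, g)]" v] less.prems by (simp add: a)
  consider "v = []" | "v \<noteq> []" "fst (last v) \<noteq> i" | "v \<noteq> []" "fst (last v) = i"
    by blast
  then show ?case
  proof cases
    case 1
    then show ?thesis
      using a less.prems by (intro bexI[of _ "\<one>\<^bsub>F\<^esub>"]) auto
  next
    case 2
    then have "fst (last a) \<noteq> fst (hd a)"
      by (simp add: a)
    then have "cyclically_reduced a"
      using less.prems by (simp add: cyclically_reduced_def reduced_words_append carrier_F one_F)
    then show ?thesis
      using less.prems by (intro bexI[of _ "\<one>\<^bsub>F\<^esub>"]) auto
  next
    case 3
    define b where "b = inv\<^bsub>F\<^esub> [(i, g)] \<otimes>\<^bsub>F\<^esub> a \<otimes>\<^bsub>F\<^esub> [(i, g)]"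
    have b: "b \<in> carrier F" "b \<noteq> \<one>\<^bsub>F\<^esub>"
      using less.prems g by (simp_all add: b_def F.conj_one_iff)
    have "b = v \<otimes>\<^bsub>F\<^esub> [(i, g)]"
      using g v by (simp add: b_def a_eq F.m_assoc flip: F.m_assoc[of "inv\<^bsub>F\<^esub> [(i, g)]" "[(i, g)]"])
    moreover obtain v' h where v': "v = v' @ [(i, h)]"
      using 3 by (metis append_butlast_last_id prod.collapse)
    have "length (v \<otimes>\<^bsub>F\<^esub> [(i, g)]) \<le> length v"
    proof -
      have "length (v \<otimes>\<^bsub>F\<^esub> [(i, g)]) \<le> length v' + length ([(i, h)] \<otimes>\<^bsub>F\<^esub> [(i, g)])"
        using length_foldr_syllable_mult_le[of G v'] by (simp add: v' mult_F)
      also have "\<dots> \<le> length v"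
        by (simp add: v' mult_F)
      finally show ?thesis .
    qed
    ultimately have "length b < length a"
      by (simp add: a)
    then obtain c where c: "c \<in> carrier F"
      "(\<exists>j k. inv\<^bsub>F\<^esub> c \<otimes>\<^bsub>F\<^esub> b \<otimes>\<^bsub>F\<^esub> c = [(j, k)]) \<or> cyclically_reduced (inv\<^bsub>F\<^esub> c \<otimes>\<^bsub>F\<^esub> b \<otimes>\<^bsub>F\<^esub> c)"
      using less.hyps b by blast
    have "inv\<^bsub>F\<^esub> c \<otimes>\<^bsub>F\<^esub> b \<otimes>\<^bsub>F\<^esub> c = inv\<^bsub>F\<^esub> ([(i, g)] \<otimes>\<^bsub>F\<^esub> c) \<otimes>\<^bsub>F\<^esub> a \<otimes>\<^bsub>F\<^esub> ([(i, g)] \<otimes>\<^bsub>F\<^esub> c)"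
      using c(1) g less.prems by (simp add: b_def F.inv_mult_group F.m_assoc)
    then show ?thesis
      using c g by (intro bexI[of _ "[(i, g)] \<otimes>\<^bsub>F\<^esub> c"]) auto
  qed
qed

section \<open>Powers of cyclically reduced words and their lengths\<close>

lemma cyclically_reduced_carrier:
  "cyclically_reduced u \<Longrightarrow> u \<in> carrier F"
  by (auto simp: cyclically_reduced_def carrier_F reduced_words_append)

text \<open>Nothing merges at the junction of two copies of \<open>u\<close>, so group powers are
  list powers and their length is linear in the exponent.\<close>

lemma cyclically_reduced_nat_pow:
  assumes u: "cyclically_reduced u"
  shows "u [^]\<^bsub>F\<^esub> (k::nat) = concat (replicate k u)"
proof -
  have uF: "u \<in> carrier F" using u by (rule cyclically_reduced_carrier)
  have "u [^]\<^bsub>F\<^esub> k = concat (replicate k u) \<and> concat (replicate k u) \<in> carrier F"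
  proof (induction k)
    case 0
    then show ?case by (simp add: one_F carrier_F)
  next
    case (Suc k)
    have "u @ concat (replicate k u) \<in> carrier F"
    proof (cases k)
      case 0
      then show ?thesis using uF by simp
    next
      case (Suc m)
      then have "hd (concat (replicate k u)) = hd u"
        using u by (simp add: cyclically_reduced_def)
      then show ?thesis
        using Suc.IH u by (auto simp: cyclically_reduced_def carrier_F reduced_words_append)
    qed
    then show ?case
      using Suc.IH append_eq_mult_F F.nat_pow_Suc2[OF uF, of k] by simp
  qed
  then show ?thesis ..
qed

lemma length_cyclically_reduced_nat_pow:
  "cyclically_reduced u \<Longrightarrow> length (u [^]\<^bsub>F\<^esub> (k::nat)) = k * length u"
  by (simp add: cyclically_reduced_nat_pow length_concat sum_list_replicate)

lemma length_cyclically_reduced_int_pow: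
  assumes "cyclically_reduced u"
  shows "length (u [^]\<^bsub>F\<^esub> (k::int)) = nat \<bar>k\<bar> * length u"
proof (cases k rule: int_cases2)
  case (nonneg n)
  then show ?thesis
    using length_cyclically_reduced_nat_pow[OF assms, of n] by (simp add: int_pow_int)
next
  case (nonpos n)
  have "length (u [^]\<^bsub>F\<^esub> k) = length (inv\<^bsub>F\<^esub> (u [^]\<^bsub>F\<^esub> n))"
    using cyclically_reduced_carrier[OF assms] by (simp only: nonpos F.int_pow_neg_int)
  then show ?thesis
    using length_cyclically_reduced_nat_pow[OF assms, of n] cyclically_reduced_carrier[OF assms]
    by (simp add: nonpos length_inv_F)
qed

lemma cyclically_reduced_pow_neq_one:
  assumes "cyclically_reduced u" "k > (0::nat)"
  shows "u [^]\<^bsub>F\<^esub> k \<noteq> \<one>\<^bsub>F\<^esub>"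
proof
  assume "u [^]\<^bsub>F\<^esub> k = \<one>\<^bsub>F\<^esub>"
  then have "k * length u = 0"
    using length_cyclically_reduced_nat_pow[OF assms(1), of k] by (simp only: one_F list.size)
  then show False
    using assms by (simp add: cyclically_reduced_def)
qed

text \<open>
  For large \<open>k\<close> the factor \<open>x\<close> cancels only inside the first \<open>k\<close> copies of \<open>u\<close> in
  \<open>x u^(k+1) = u (x u^k)\<close>, so the right-hand product has length \<open>|u| + |x u^k|\<close>, hence is a
  concatenation. Commutation in the free product thus becomes commutation of lists.
\<close>

lemma commute_cyclically_reduced:
  assumes u: "cyclically_reduced u" and x: "x \<in> carrier F"
    and ux: "u \<otimes>\<^bsub>F\<^esub> x = x \<otimes>\<^bsub>F\<^esub> u"
  shows "\<exists>k::nat. (x \<otimes>\<^bsub>F\<^esub> u [^]\<^bsub>F\<^esub> k) @ u = u @ (x \<otimes>\<^bsub>F\<^esub> u [^]\<^bsub>F\<^esub> k) \<and> x \<otimes>\<^bsub>F\<^esub> u [^]\<^bsub>F\<^esub> k \<noteq> []"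
proof -
  have uF: "u \<in> carrier F" using u by (rule cyclically_reduced_carrier)
  \<comment> \<open>The successor makes the power strictly longer than \<open>x\<close>, so that
    \<open>z\<close> cannot be empty.\<close>
  define k where "k = Suc (length x)"
  define z where "z = x \<otimes>\<^bsub>F\<^esub> u [^]\<^bsub>F\<^esub> k"
  have "length u \<ge> 1"
    using u by (cases u) (auto simp: cyclically_reduced_def)
  then have len: "length (u [^]\<^bsub>F\<^esub> k) > length x"
    using length_cyclically_reduced_nat_pow[OF u, of k] by (cases "length u") (auto simp: k_def)
  then have "z \<noteq> []"
    using length_le_foldr_syllable_mult[of "u [^]\<^bsub>F\<^esub> k" x G] by (auto simp: z_def mult_F)
  have "concat (replicate (k + 1) u) = concat (replicate k u) @ u"
    by (simp only: replicate_add) simp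
  then have "u [^]\<^bsub>F\<^esub> Suc k = u [^]\<^bsub>F\<^esub> k @ u"
    by (simp only: cyclically_reduced_nat_pow[OF u] Suc_eq_plus1)
  then have "x \<otimes>\<^bsub>F\<^esub> u [^]\<^bsub>F\<^esub> Suc k = z @ u"
    using foldr_syllable_mult_append[of x "u [^]\<^bsub>F\<^esub> k" G u] len by (simp only: z_def mult_F)
  moreover have "x \<otimes>\<^bsub>F\<^esub> u [^]\<^bsub>F\<^esub> Suc k = u \<otimes>\<^bsub>F\<^esub> z"
  proof -
    have "x \<otimes>\<^bsub>F\<^esub> u [^]\<^bsub>F\<^esub> Suc k = (x \<otimes>\<^bsub>F\<^esub> u) \<otimes>\<^bsub>F\<^esub> u [^]\<^bsub>F\<^esub> k"
      using x uF F.nat_pow_Suc2[OF uF, of k] by (simp add: F.m_assoc)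
    also have "\<dots> = u \<otimes>\<^bsub>F\<^esub> z"
      using x uF by (simp add: z_def F.m_assoc flip: ux)
    finally show ?thesis .
  qed
  ultimately have uz: "u \<otimes>\<^bsub>F\<^esub> z = z @ u"
    by simp
  then have "u \<otimes>\<^bsub>F\<^esub> z = u @ z"
    using foldr_syllable_mult_eq_append[of G u z] by (simp add: mult_F)
  then have "z @ u = u @ z"
    using uz by simp
  then show ?thesis
    using \<open>z \<noteq> []\<close> unfolding z_def by blast
qed

text \<open>A nonempty list commuting with \<open>u\<close> begins and ends with the same syllables
  as \<open>u\<close>, so the junction of \<open>z\<close> and \<open>y\<close> looks like that of
  \<open>u @ u\<close>.\<close>

lemma cyclically_reduced_append:
  assumes u: "cyclically_reduced u"
    and z: "z \<in> carrier F" "z @ u = u @ z" "z \<noteq> []"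
    and y: "y \<in> carrier F" "y @ u = u @ y"
  shows "z @ y \<in> carrier F"
proof (cases "y = []")
  case False
  have uF: "u \<noteq> []"
    using u by (simp add: cyclically_reduced_def)
  have "hd y = hd u" "last z = last u"
    using False uF z y by (metis hd_append2, metis last_append)
  then show ?thesis
    using u z(1,3) y(1) by (auto simp: cyclically_reduced_def carrier_F reduced_words_append)
qed (use z in simp)

text \<open>After multiplication by powers of \<open>u\<close>, both elements commute with
  \<open>u\<close> as lists, hence with each other. Their concatenations are reduced and so are
  group products, from which the powers of \<open>u\<close> cancel.\<close>

lemma centralizer_abelian_at_cyclically_reduced:
  assumes u: "cyclically_reduced u"
  shows "centralizer_abelian_at F u"
  unfolding centralizer_abelian_at_def
proof (intro ballI impI)
  fix x y
  assume x: "x \<in> carrier F" and y: "y \<in> carrier F"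
    and ux: "u \<otimes>\<^bsub>F\<^esub> x = x \<otimes>\<^bsub>F\<^esub> u" and uy: "u \<otimes>\<^bsub>F\<^esub> y = y \<otimes>\<^bsub>F\<^esub> u"
  have uF: "u \<in> carrier F" using u by (rule cyclically_reduced_carrier)
  obtain k l :: nat where
    k: "(x \<otimes>\<^bsub>F\<^esub> u [^]\<^bsub>F\<^esub> k) @ u = u @ (x \<otimes>\<^bsub>F\<^esub> u [^]\<^bsub>F\<^esub> k)" "x \<otimes>\<^bsub>F\<^esub> u [^]\<^bsub>F\<^esub> k \<noteq> []" and
    l: "(y \<otimes>\<^bsub>F\<^esub> u [^]\<^bsub>F\<^esub> l) @ u = u @ (y \<otimes>\<^bsub>F\<^esub> u [^]\<^bsub>F\<^esub> l)" "y \<otimes>\<^bsub>F\<^esub> u [^]\<^bsub>F\<^esub> l \<noteq> []"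
    using commute_cyclically_reduced[OF u x ux] commute_cyclically_reduced[OF u y uy] by blast
  define a b where "a = u [^]\<^bsub>F\<^esub> k" and "b = u [^]\<^bsub>F\<^esub> l"
  have ab: "a \<in> carrier F" "b \<in> carrier F" "a \<otimes>\<^bsub>F\<^esub> b = b \<otimes>\<^bsub>F\<^esub> a"
    using uF by (simp_all add: a_def b_def F.nat_pow_comm)
  have ay: "a \<otimes>\<^bsub>F\<^esub> y = y \<otimes>\<^bsub>F\<^esub> a" and xb: "b \<otimes>\<^bsub>F\<^esub> x = x \<otimes>\<^bsub>F\<^esub> b"
    using F.commute_nat_pow uF x y ux uy by (simp_all add: a_def b_def)
  have xa: "x \<otimes>\<^bsub>F\<^esub> a \<in> carrier F" and yb: "y \<otimes>\<^bsub>F\<^esub> b \<in> carrier F"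
    using x y ab by simp_all
  have "u \<noteq> []" using u by (simp add: cyclically_reduced_def)
  then have "(x \<otimes>\<^bsub>F\<^esub> a) @ (y \<otimes>\<^bsub>F\<^esub> b) = (y \<otimes>\<^bsub>F\<^esub> b) @ (x \<otimes>\<^bsub>F\<^esub> a)"
    using comm_append_trans[of u] k l by (simp add: a_def b_def)
  then have "(x \<otimes>\<^bsub>F\<^esub> a) \<otimes>\<^bsub>F\<^esub> (y \<otimes>\<^bsub>F\<^esub> b) = (y \<otimes>\<^bsub>F\<^esub> b) \<otimes>\<^bsub>F\<^esub> (x \<otimes>\<^bsub>F\<^esub> a)"
    using append_eq_mult_F cyclically_reduced_append[OF u xa _ _ yb] cyclically_reduced_append[OF u yb _ _ xa] k l
    by (metis a_def b_def)
  moreover have "(x \<otimes>\<^bsub>F\<^esub> a) \<otimes>\<^bsub>F\<^esub> (y \<otimes>\<^bsub>F\<^esub> b) = (x \<otimes>\<^bsub>F\<^esub> y) \<otimes>\<^bsub>F\<^esub> (a \<otimes>\<^bsub>F\<^esub> b)"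
    using x y ab(1,2) ay by (metis F.m_assoc F.m_closed)
  moreover have "(y \<otimes>\<^bsub>F\<^esub> b) \<otimes>\<^bsub>F\<^esub> (x \<otimes>\<^bsub>F\<^esub> a) = (y \<otimes>\<^bsub>F\<^esub> x) \<otimes>\<^bsub>F\<^esub> (a \<otimes>\<^bsub>F\<^esub> b)"
    using x y ab xb by (metis F.m_assoc F.m_closed)
  ultimately show "x \<otimes>\<^bsub>F\<^esub> y = y \<otimes>\<^bsub>F\<^esub> x"
    using x y ab(1,2) by simp
qed

text \<open>The lists \<open>u\<close> and \<open>z = x u^k\<close> commute, so they are powers
  \<open>r^m\<close> and \<open>r^n\<close> of one list \<open>r\<close>. Then
  \<open>z^m = u^n\<close>, which gives \<open>x^m = u^(n - k m)\<close>.\<close>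

lemma commute_cyclically_reduced_pow:
  assumes u: "cyclically_reduced u" and x: "x \<in> carrier F"
    and ux: "u \<otimes>\<^bsub>F\<^esub> x = x \<otimes>\<^bsub>F\<^esub> u"
  shows "\<exists>(m::nat) (s::int). m > 0 \<and> x [^]\<^bsub>F\<^esub> m = u [^]\<^bsub>F\<^esub> s"
proof -
  have uF: "u \<in> carrier F" using u by (rule cyclically_reduced_carrier)
  obtain k :: nat where k: "(x \<otimes>\<^bsub>F\<^esub> u [^]\<^bsub>F\<^esub> k) @ u = u @ (x \<otimes>\<^bsub>F\<^esub> u [^]\<^bsub>F\<^esub> k)" "x \<otimes>\<^bsub>F\<^esub> u [^]\<^bsub>F\<^esub> k \<noteq> []"
    using commute_cyclically_reduced[OF assms] by blast
  define z where "z = x \<otimes>\<^bsub>F\<^esub> u [^]\<^bsub>F\<^esub> k"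
  have zF: "z \<in> carrier F" using x uF by (simp add: z_def)
  have zu: "z @ u = u @ z" "z \<noteq> []" using k by (simp_all add: z_def)
  \<comment> \<open>Taking \<open>z\<close> for both lists shows that \<open>z @ z\<close> is
    reduced, so powers of \<open>z\<close> are list powers too.\<close>
  have z: "cyclically_reduced z"
    using cyclically_reduced_append[OF u zF zu zF zu(1)] zu(2) by (simp add: cyclically_reduced_def carrier_F)
  obtain m n r where r: "concat (replicate m r) = u" "concat (replicate n r) = z"
    using comm_append_are_replicate[OF zu(1)[symmetric]] by blast
  have "m > 0"
    using r(1) u by (cases m) (auto simp: cyclically_reduced_def)
  have "z [^]\<^bsub>F\<^esub> m = u [^]\<^bsub>F\<^esub> n"
    using concat_replicate_concat_replicate[of m n r] concat_replicate_concat_replicate[of n m r]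
    by (simp add: cyclically_reduced_nat_pow u z r mult.commute)
  moreover have "z [^]\<^bsub>F\<^esub> m = x [^]\<^bsub>F\<^esub> m \<otimes>\<^bsub>F\<^esub> u [^]\<^bsub>F\<^esub> (k * m)"
    using F.pow_mult_distrib[of x "u [^]\<^bsub>F\<^esub> k" m] F.commute_nat_pow[OF uF x ux, of k] x uF
    by (simp add: z_def F.nat_pow_pow)
  ultimately have "x [^]\<^bsub>F\<^esub> m = u [^]\<^bsub>F\<^esub> n \<otimes>\<^bsub>F\<^esub> inv\<^bsub>F\<^esub> (u [^]\<^bsub>F\<^esub> (k * m))"
    using x uF by (simp add: F.inv_solve_right)
  also have "\<dots> = u [^]\<^bsub>F\<^esub> (int n - int (k * m))"
    using uF by (simp only: F.int_pow_diff int_pow_int)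
  finally show ?thesis
    using \<open>m > 0\<close> by blast
qed

text \<open>Leaves two cases for the action of \<open>x\<close> on a power of \<open>u\<close>:
  fixing it or inverting it.\<close>

lemma conj_cyclically_reduced_pow:
  assumes u: "cyclically_reduced u" and x: "x \<in> carrier F"
    and eq: "inv\<^bsub>F\<^esub> x \<otimes>\<^bsub>F\<^esub> u [^]\<^bsub>F\<^esub> (m::nat) \<otimes>\<^bsub>F\<^esub> x = u [^]\<^bsub>F\<^esub> (s::int)"
  shows "\<bar>s\<bar> = int m"
proof -
  have uF: "u \<in> carrier F" using u by (rule cyclically_reduced_carrier)
  \<comment> \<open>Conjugation by \<open>x\<close> changes lengths by at most \<open>2|x|\<close>, less than \<open>N\<close>; compare \<open>N\<close>-th powers.\<close>
  define N where "N = Suc (2 * length x)"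
  have len_pos: "length u > 0" using u by (simp add: cyclically_reduced_def)
  have conj: "inv\<^bsub>F\<^esub> x \<otimes>\<^bsub>F\<^esub> u [^]\<^bsub>F\<^esub> (m * N) \<otimes>\<^bsub>F\<^esub> x = u [^]\<^bsub>F\<^esub> (s * int N)"
  proof -
    have "inv\<^bsub>F\<^esub> x \<otimes>\<^bsub>F\<^esub> u [^]\<^bsub>F\<^esub> (m * N) \<otimes>\<^bsub>F\<^esub> x = (u [^]\<^bsub>F\<^esub> s) [^]\<^bsub>F\<^esub> N"
      using F.conj_nat_pow[OF x, of "u [^]\<^bsub>F\<^esub> m" N] uF eq by (simp add: F.nat_pow_pow)
    then show ?thesis
      using uF by (simp add: F.int_pow_pow flip: int_pow_int)
  qed
  have conj': "u [^]\<^bsub>F\<^esub> (m * N) = x \<otimes>\<^bsub>F\<^esub> u [^]\<^bsub>F\<^esub> (s * int N) \<otimes>\<^bsub>F\<^esub> inv\<^bsub>F\<^esub> x"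
    unfolding conj[symmetric] using x uF by (simp add: F.m_assoc flip: F.m_assoc[of x "inv\<^bsub>F\<^esub> x"])
  have len: "length (u [^]\<^bsub>F\<^esub> (m * N)) = m * N * length u"
    "length (u [^]\<^bsub>F\<^esub> (s * int N)) = nat \<bar>s\<bar> * N * length u"
    using length_cyclically_reduced_nat_pow[OF u] length_cyclically_reduced_int_pow[OF u]
    by (simp_all add: abs_mult nat_mult_distrib)
  have "nat \<bar>s\<bar> * N * length u < m * N * length u + N"
    using length_mult_F_le[of "inv\<^bsub>F\<^esub> x \<otimes>\<^bsub>F\<^esub> u [^]\<^bsub>F\<^esub> (m * N)" x] length_mult_F_le[of "inv\<^bsub>F\<^esub> x" "u [^]\<^bsub>F\<^esub> (m * N)"]
      length_inv_F[OF x] len conj by (simp add: N_def)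
  moreover have "m * N * length u < nat \<bar>s\<bar> * N * length u + N"
    using length_mult_F_le[of "x \<otimes>\<^bsub>F\<^esub> u [^]\<^bsub>F\<^esub> (s * int N)" "inv\<^bsub>F\<^esub> x"] length_mult_F_le[of x "u [^]\<^bsub>F\<^esub> (s * int N)"]
      length_inv_F[OF x] len conj' by (simp add: N_def)
  \<comment> \<open>The error is below \<open>N\<close>, so dividing by \<open>N\<close> leaves
    \<open>p |u| < q |u| + 1\<close>, a comparison without error term.\<close>
  moreover have "p \<le> q" if "p * N * length u < q * N * length u + N" for p q
  proof -
    have "N * (p * length u) < N * (q * length u + 1)"
      using that by (simp add: algebra_simps)
    then have "p * length u < q * length u + 1"
      using mult_less_cancel1 by blast
    then show ?thesis
      using len_pos by (simp add: less_Suc_eq_le)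
  qed
  ultimately have "nat \<bar>s\<bar> = m"
    by (simp add: antisym)
  then show ?thesis by simp
qed

end

section \<open>Free products of CSA*-groups\<close>

locale CSA_star_family =
  fixes I :: "'i set" and G :: "'i \<Rightarrow> ('a, 'b) monoid_scheme"
  assumes CSA_star: "\<And>i. i \<in> I \<Longrightarrow> CSA_star_group (G i)"
begin

sublocale group_family I G
  by (rule group_family.intro) (use CSA_star in \<open>simp add: CSA_star_group_def CSA_group_def\<close>)

lemma factor:
  assumes "[(i, g)] \<in> carrier F"
  shows "centralizer_abelian_at (G i) g" "conjugates_separated_at (G i) g" "g \<otimes>\<^bsub>G i\<^esub> g \<noteq> \<one>\<^bsub>G i\<^esub>"
  using assms CSA_star groups group.CSA_star_group_iff[of "G i"] by (auto simp: singleton_in_F)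

lemma centralizer_abelian_at_F:
  assumes a: "a \<in> carrier F" "a \<noteq> \<one>\<^bsub>F\<^esub>"
  shows "centralizer_abelian_at F a"
proof -
  obtain c where c: "c \<in> carrier F" "(\<exists>i g. inv\<^bsub>F\<^esub> c \<otimes>\<^bsub>F\<^esub> a \<otimes>\<^bsub>F\<^esub> c = [(i, g)]) \<or>
      cyclically_reduced (inv\<^bsub>F\<^esub> c \<otimes>\<^bsub>F\<^esub> a \<otimes>\<^bsub>F\<^esub> c)"
    using ex_conj_cyclically_reduced[OF a] by blast
  have "inv\<^bsub>F\<^esub> c \<otimes>\<^bsub>F\<^esub> a \<otimes>\<^bsub>F\<^esub> c \<in> carrier F"
    using a c by simp
  then have "centralizer_abelian_at F (inv\<^bsub>F\<^esub> c \<otimes>\<^bsub>F\<^esub> a \<otimes>\<^bsub>F\<^esub> c)"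
    using c(2) centralizer_abelian_at_cyclically_reduced centralizer_abelian_at_singleton factor
    by metis
  then show ?thesis
    using F.centralizer_abelian_at_conj a c by blast
qed

text \<open>Commutation passes through any nontrivial \<open>a\<close>. Below, the intermediate
  element is a power of \<open>u\<close> or the square of \<open>x\<close>.\<close>

lemma commute_trans:
  assumes "a \<in> carrier F" "a \<noteq> \<one>\<^bsub>F\<^esub>" "x \<in> carrier F" "y \<in> carrier F"
    and "a \<otimes>\<^bsub>F\<^esub> x = x \<otimes>\<^bsub>F\<^esub> a" "a \<otimes>\<^bsub>F\<^esub> y = y \<otimes>\<^bsub>F\<^esub> a"
  shows "x \<otimes>\<^bsub>F\<^esub> y = y \<otimes>\<^bsub>F\<^esub> x"
  using centralizer_abelian_at_F assms unfolding centralizer_abelian_at_def by blast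

text \<open>Up to conjugation, either \<open>a\<close> is a syllable and its factor has no elements
  of order 2, or its square is the nonempty word \<open>b @ b\<close>.\<close>

lemma square_neq_one:
  assumes a: "a \<in> carrier F" "a \<noteq> \<one>\<^bsub>F\<^esub>"
  shows "a \<otimes>\<^bsub>F\<^esub> a \<noteq> \<one>\<^bsub>F\<^esub>"
proof -
  obtain c where c: "c \<in> carrier F" "(\<exists>i g. inv\<^bsub>F\<^esub> c \<otimes>\<^bsub>F\<^esub> a \<otimes>\<^bsub>F\<^esub> c = [(i, g)]) \<or>
      cyclically_reduced (inv\<^bsub>F\<^esub> c \<otimes>\<^bsub>F\<^esub> a \<otimes>\<^bsub>F\<^esub> c)"
    using ex_conj_cyclically_reduced[OF a] by blast
  define b where "b = inv\<^bsub>F\<^esub> c \<otimes>\<^bsub>F\<^esub> a \<otimes>\<^bsub>F\<^esub> c"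
  have bF: "b \<in> carrier F"
    using a c by (simp add: b_def)
  have "b \<otimes>\<^bsub>F\<^esub> b \<noteq> []"
    using c(2)[folded b_def]
  proof
    assume "\<exists>i g. b = [(i, g)]"
    then obtain i g where b: "b = [(i, g)]" by blast
    then show ?thesis using factor(3)[of i g] bF by (auto simp: mult_F)
  next
    assume "cyclically_reduced b"
    then show ?thesis
      using append_eq_mult_F[of b b] by (simp add: cyclically_reduced_def carrier_F)
  qed
  then have "inv\<^bsub>F\<^esub> c \<otimes>\<^bsub>F\<^esub> (a \<otimes>\<^bsub>F\<^esub> a) \<otimes>\<^bsub>F\<^esub> c \<noteq> \<one>\<^bsub>F\<^esub>"
    using F.conj_mult[OF c(1) a(1) a(1)] by (simp add: b_def one_F)
  then show ?thesis
    using c(1) by auto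
qed

lemma conjugates_separated_at_cyclically_reduced:
  assumes u: "cyclically_reduced u"
  shows "conjugates_separated_at F u"
  unfolding conjugates_separated_at_def
proof (intro ballI impI)
  fix x
  assume x: "x \<in> carrier F"
  have uF: "u \<in> carrier F" using u by (rule cyclically_reduced_carrier)
  define v where "v = inv\<^bsub>F\<^esub> x \<otimes>\<^bsub>F\<^esub> u \<otimes>\<^bsub>F\<^esub> x"
  have vF: "v \<in> carrier F" using x uF by (simp add: v_def)
  assume "u \<otimes>\<^bsub>F\<^esub> (inv\<^bsub>F\<^esub> x \<otimes>\<^bsub>F\<^esub> u \<otimes>\<^bsub>F\<^esub> x) = inv\<^bsub>F\<^esub> x \<otimes>\<^bsub>F\<^esub> u \<otimes>\<^bsub>F\<^esub> x \<otimes>\<^bsub>F\<^esub> u"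
  then have "u \<otimes>\<^bsub>F\<^esub> v = v \<otimes>\<^bsub>F\<^esub> u"
    by (simp add: v_def)
  then obtain m :: nat and s :: int where m: "m > 0" and "v [^]\<^bsub>F\<^esub> m = u [^]\<^bsub>F\<^esub> s"
    using commute_cyclically_reduced_pow[OF u vF] by blast
  then have conj: "inv\<^bsub>F\<^esub> x \<otimes>\<^bsub>F\<^esub> u [^]\<^bsub>F\<^esub> m \<otimes>\<^bsub>F\<^esub> x = u [^]\<^bsub>F\<^esub> s"
    using F.conj_nat_pow[OF x uF] by (simp add: v_def)
  \<comment> \<open>A nontrivial element commuting with \<open>u\<close>: whatever commutes with
    \<open>a\<close> also commutes with \<open>u\<close>.\<close>
  define a where "a = u [^]\<^bsub>F\<^esub> m"
  have a: "a \<in> carrier F" "a \<noteq> \<one>\<^bsub>F\<^esub>" "a \<otimes>\<^bsub>F\<^esub> u = u \<otimes>\<^bsub>F\<^esub> a"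
    using uF cyclically_reduced_pow_neq_one[OF u m] F.commute_nat_pow[OF uF uF] by (simp_all add: a_def)
  have "s = int m \<or> s = - int m"
    using conj_cyclically_reduced_pow[OF u x conj] by linarith
  then show "u \<otimes>\<^bsub>F\<^esub> x = x \<otimes>\<^bsub>F\<^esub> u"
  proof
    assume "s = int m"
    then have "inv\<^bsub>F\<^esub> x \<otimes>\<^bsub>F\<^esub> a \<otimes>\<^bsub>F\<^esub> x = a"
      using conj by (simp add: a_def int_pow_int)
    then have "a \<otimes>\<^bsub>F\<^esub> x = x \<otimes>\<^bsub>F\<^esub> a"
      using a x by (metis F.inv_closed F.inv_solve_left F.m_assoc F.m_closed)
    then show ?thesis
      using commute_trans[OF a(1,2) uF x] a(3) by blast
  next
    assume "s = - int m"
    then have inv: "inv\<^bsub>F\<^esub> x \<otimes>\<^bsub>F\<^esub> a \<otimes>\<^bsub>F\<^esub> x = inv\<^bsub>F\<^esub> a"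
      using conj uF by (simp add: a_def F.int_pow_neg_int)
    then have ax: "a \<otimes>\<^bsub>F\<^esub> x = x \<otimes>\<^bsub>F\<^esub> inv\<^bsub>F\<^esub> a"
      using a x by (metis F.inv_closed F.inv_solve_left F.m_assoc F.m_closed)
    have "inv\<^bsub>F\<^esub> x \<otimes>\<^bsub>F\<^esub> inv\<^bsub>F\<^esub> a \<otimes>\<^bsub>F\<^esub> x = a"
      using F.conj_inv[OF x a(1)] inv a by simp
    then have ax': "inv\<^bsub>F\<^esub> a \<otimes>\<^bsub>F\<^esub> x = x \<otimes>\<^bsub>F\<^esub> a"
      using a x by (metis F.inv_closed F.inv_solve_left F.m_assoc F.m_closed)
    \<comment> \<open>Conjugation by \<open>x\<close> inverts \<open>a\<close>, so doing it twice
      fixes \<open>a\<close>.\<close>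
    have axx: "a \<otimes>\<^bsub>F\<^esub> (x \<otimes>\<^bsub>F\<^esub> x) = (x \<otimes>\<^bsub>F\<^esub> x) \<otimes>\<^bsub>F\<^esub> a"
      using ax ax' a x by (metis F.inv_closed F.m_assoc)
    show ?thesis
    proof (cases "x = \<one>\<^bsub>F\<^esub>")
      case False
      have "(x \<otimes>\<^bsub>F\<^esub> x) \<otimes>\<^bsub>F\<^esub> u = u \<otimes>\<^bsub>F\<^esub> (x \<otimes>\<^bsub>F\<^esub> x)"
        using commute_trans[OF a(1,2) _ uF axx a(3)] x by simp
      then show ?thesis
        \<comment> \<open>The absence of elements of order 2 enters here: the square of
          \<open>x\<close> is nontrivial and commutes with both \<open>u\<close> and
          \<open>x\<close>.\<close>
        using commute_trans[OF _ square_neq_one[OF x False] uF x] x by (simp add: F.m_assoc)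
    qed (use uF in simp)
  qed
qed

lemma conjugates_separated_at_F:
  assumes a: "a \<in> carrier F" "a \<noteq> \<one>\<^bsub>F\<^esub>"
  shows "conjugates_separated_at F a"
proof -
  obtain c where c: "c \<in> carrier F" "(\<exists>i g. inv\<^bsub>F\<^esub> c \<otimes>\<^bsub>F\<^esub> a \<otimes>\<^bsub>F\<^esub> c = [(i, g)]) \<or>
      cyclically_reduced (inv\<^bsub>F\<^esub> c \<otimes>\<^bsub>F\<^esub> a \<otimes>\<^bsub>F\<^esub> c)"
    using ex_conj_cyclically_reduced[OF a] by blast
  have "inv\<^bsub>F\<^esub> c \<otimes>\<^bsub>F\<^esub> a \<otimes>\<^bsub>F\<^esub> c \<in> carrier F"
    using a c by simp
  then have "conjugates_separated_at F (inv\<^bsub>F\<^esub> c \<otimes>\<^bsub>F\<^esub> a \<otimes>\<^bsub>F\<^esub> c)"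
    using c(2) conjugates_separated_at_cyclically_reduced conjugates_separated_at_singleton factor
    by metis
  then show ?thesis
    using F.conjugates_separated_at_conj a c by blast
qed

end

theorem theorem4:
  fixes I :: "'i set" and G :: "'i \<Rightarrow> ('a, 'b) monoid_scheme"
  assumes "\<And>i. i \<in> I \<Longrightarrow> CSA_star_group (G i)"
  shows "CSA_star_group (free_product I G)"
proof -
  interpret CSA_star_family I G
    by unfold_locales (rule assms)
  show ?thesis
    using F.CSA_star_group_iff centralizer_abelian_at_F conjugates_separated_at_F square_neq_one
    by blast
qed

end
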